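(* Let $A=\{A_1,\dots,A_m\}$ be a non-disjoint $(n_a,m,k_a,\lambda_a)$-PSEDF in a group $G_a$ and $B=\{B_1,\dots,B_m\}$ a non-disjoint $(n_b,m,k_b,\lambda_b)$-PSEDF in a group $G_b$. Then $L=\{A_i\times B_i:1\le i\le m\}$ is a non-disjoint $(n_an_b,m,k_ak_b,\lambda_a\lambda_b)$-PSEDF in $G_a\times G_b$.
   Context: For subsets $A,B$ of an additively written group $G$, $\Delta(A,B)$ denotes the multiset $\{a-b:a\in A,b\in B\}$ (one entry per pair). For $\lambda\in\mathbb{N}$, $\lambda G$ is the multiset containing every element of $G$ exactly $\lambda$ times. For a group $G$ of order $v$ and $m>1$, a family of $k$-subsets $\{A_1,\dots,A_m\}$ of $G$ is a non-disjoint $(v,m,k,\lambda)$-PSEDF if $\Delta(A_i,A_j)=\lambda G$ for all $1\le i\ne j\le m$. *)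

theory Defs
  imports "HOL-Algebra.Coset" "HOL-Library.Multiset"
begin

text \<open>
  Groups are HOL-Algebra groups, not necessarily commutative, so the additively written
  difference \<open>a - b\<close> appears as \<open>a \<otimes> inv b\<close>. The multiset \<open>\<Delta>(A,B)\<close> has one entry per pair;
  \<^const>\<open>mset_set\<close> is empty on infinite sets, so it is meaningful only for finite \<open>A\<close> and \<open>B\<close>.
\<close>

definition diff_mset :: "('a, 'c) monoid_scheme \<Rightarrow> 'a set \<Rightarrow> 'a set \<Rightarrow> 'a multiset" where
  "diff_mset G A B = image_mset (\<lambda>(a, b). a \<otimes>\<^bsub>G\<^esub> inv\<^bsub>G\<^esub> b) (mset_set (A \<times> B))"

definition group_mset :: "nat \<Rightarrow> ('a, 'c) monoid_scheme \<Rightarrow> 'a multiset" where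
  "group_mset l G = repeat_mset l (mset_set (carrier G))"

text \<open>
  The family \<open>A\<^sub>1, \<dots>, A\<^sub>m\<close> is indexed: its members are not required to be distinct or disjoint,
  and values of \<open>A\<close> outside \<open>{1..m}\<close> are irrelevant. Finiteness of the carrier is explicit
  because \<^const>\<open>order\<close> is \<open>0\<close> for an infinite group; it also makes every \<open>A i\<close> finite.
\<close>

definition nondisjoint_PSEDF ::
  "('a, 'c) monoid_scheme \<Rightarrow> nat \<Rightarrow> nat \<Rightarrow> nat \<Rightarrow> nat \<Rightarrow> (nat \<Rightarrow> 'a set) \<Rightarrow> bool" where
  "nondisjoint_PSEDF G v m k l A \<longleftrightarrow>
     group G \<and> finite (carrier G) \<and> order G = v \<and> m > 1 \<and>
     (\<forall>i\<in>{1..m}. A i \<subseteq> carrier G \<and> card (A i) = k) \<and>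
     (\<forall>i\<in>{1..m}. \<forall>j\<in>{1..m}. i \<noteq> j \<longrightarrow> diff_mset G (A i) (A j) = group_mset l G)"

end

theory Submission
  imports Defs
begin

text \<open>Subtraction in a direct product is componentwise, so \<open>(a, b)\<close> minus
  \<open>(a', b')\<close> equals \<open>(x, y)\<close> exactly when \<open>a\<close> minus
  \<open>a'\<close> is \<open>x\<close> and \<open>b\<close> minus \<open>b'\<close> is
  \<open>y\<close>. The two conditions are independent, hence multiplicities in difference multisets
  of product sets multiply (\<open>count_diff_mset_DirProd\<close>). For indices
  \<open>i \<noteq> j\<close> the two factors are the constants \<open>la\<close> and
  \<open>lb\<close> on the carriers, which gives \<open>la * lb\<close> throughout the product
  group.\<close>

text \<open>Turns equality of difference multisets into counting pairs: each pair of the finite set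
  \<open>A \<times> B\<close> contributes one entry to its own difference.\<close>

lemma count_diff_mset:
  assumes "finite A" and "finite B"
  shows "count (diff_mset G A B) x = card {(a, b). a \<in> A \<and> b \<in> B \<and> a \<otimes>\<^bsub>G\<^esub> inv\<^bsub>G\<^esub> b = x}"
proof -
  let ?f = "\<lambda>(a, b). a \<otimes>\<^bsub>G\<^esub> inv\<^bsub>G\<^esub> b"
  have "count (diff_mset G A B) x = (\<Sum>p | p \<in> A \<times> B \<and> x = ?f p. count (mset_set (A \<times> B)) p)"
    using assms by (simp add: diff_mset_def count_image_mset')
  also have "\<dots> = card {p \<in> A \<times> B. x = ?f p}"
    using assms by simp
  also have "{p \<in> A \<times> B. x = ?f p} = {(a, b). a \<in> A \<and> b \<in> B \<and> a \<otimes>\<^bsub>G\<^esub> inv\<^bsub>G\<^esub> b = x}"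
    by auto
  finally show ?thesis .
qed

lemma count_group_mset:
  "finite (carrier G) \<Longrightarrow> count (group_mset l G) x = (if x \<in> carrier G then l else 0)"
  by (simp add: group_mset_def)

lemma count_diff_mset_DirProd:
  assumes "group G" and "group H"
    and "finite A" and "finite A'" and "finite B" and "finite B'"
    and "A' \<subseteq> carrier G" and "B' \<subseteq> carrier H"
  shows "count (diff_mset (G \<times>\<times> H) (A \<times> B) (A' \<times> B')) (x, y) =
    count (diff_mset G A A') x * count (diff_mset H B B') y"
proof -
  let ?S = "{(p, q). p \<in> A \<times> B \<and> q \<in> A' \<times> B' \<and> p \<otimes>\<^bsub>G \<times>\<times> H\<^esub> inv\<^bsub>G \<times>\<times> H\<^esub> q = (x, y)}"
  let ?SG = "{(a, a'). a \<in> A \<and> a' \<in> A' \<and> a \<otimes>\<^bsub>G\<^esub> inv\<^bsub>G\<^esub> a' = x}"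
  let ?SH = "{(b, b'). b \<in> B \<and> b' \<in> B' \<and> b \<otimes>\<^bsub>H\<^esub> inv\<^bsub>H\<^esub> b' = y}"
  \<comment> \<open>\<open>inv_DirProd\<close> applies to carrier elements; this is where the
    subtrahend sets \<open>A'\<close> and \<open>B'\<close> must lie in the carriers.\<close>
  have inv: "inv\<^bsub>G \<times>\<times> H\<^esub> (a', b') = (inv\<^bsub>G\<^esub> a', inv\<^bsub>H\<^esub> b')" if "a' \<in> A'" "b' \<in> B'" for a' b'
    using that assms by (intro inv_DirProd) auto
  \<comment> \<open>Swapping the two middle coordinates regroups a pair of points of the product
    into a pair over \<open>G\<close> and a pair over \<open>H\<close>; the same swap undoes
    it.\<close>
  have "bij_betw (\<lambda>((a, b), (a', b')). ((a, a'), (b, b'))) ?S (?SG \<times> ?SH)"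
    by (rule bij_betw_byWitness[where f' = "\<lambda>((a, a'), (b, b')). ((a, b), (a', b'))"])
      (auto simp: inv)
  then have "card ?S = card ?SG * card ?SH"
    by (simp add: bij_betw_same_card card_cartesian_product)
  with assms show ?thesis
    by (simp add: count_diff_mset)
qed

theorem theorem5p1:
  fixes Ga :: "('a, 'c) monoid_scheme" and Gb :: "('b, 'd) monoid_scheme"
    and A :: "nat \<Rightarrow> 'a set" and B :: "nat \<Rightarrow> 'b set"
    and na nb m ka kb la lb :: nat
  assumes "nondisjoint_PSEDF Ga na m ka la A"
    and "nondisjoint_PSEDF Gb nb m kb lb B"
  shows "nondisjoint_PSEDF (Ga \<times>\<times> Gb) (na * nb) m (ka * kb) (la * lb) (\<lambda>i. A i \<times> B i)"
proof -
  have groups: "group Ga" "group Gb"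
    and fin: "finite (carrier Ga)" "finite (carrier Gb)"
    and ord: "order Ga = na" "order Gb = nb"
    and m: "m > 1"
    and A: "\<And>i. i \<in> {1..m} \<Longrightarrow> A i \<subseteq> carrier Ga \<and> card (A i) = ka"
    and B: "\<And>i. i \<in> {1..m} \<Longrightarrow> B i \<subseteq> carrier Gb \<and> card (B i) = kb"
    and diff: "\<And>i j. i \<in> {1..m} \<Longrightarrow> j \<in> {1..m} \<Longrightarrow> i \<noteq> j \<Longrightarrow>
      diff_mset Ga (A i) (A j) = group_mset la Ga \<and> diff_mset Gb (B i) (B j) = group_mset lb Gb"
    using assms unfolding nondisjoint_PSEDF_def by blast+
  have finAB: "finite (A i)" "finite (B i)" if "i \<in> {1..m}" for i
    using A[OF that] B[OF that] fin finite_subset by blast+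
  have "diff_mset (Ga \<times>\<times> Gb) (A i \<times> B i) (A j \<times> B j) = group_mset (la * lb) (Ga \<times>\<times> Gb)"
    if ij: "i \<in> {1..m}" "j \<in> {1..m}" "i \<noteq> j" for i j
  proof (rule multiset_eqI)
    fix z :: "'a \<times> 'b"
    obtain x y where z: "z = (x, y)"
      by (cases z)
    \<comment> \<open>The product family pairs \<open>A i\<close> with \<open>B i\<close> at the
      same index, so \<open>i \<noteq> j\<close> makes both hypotheses on differences available at
      once.\<close>
    have "count (diff_mset (Ga \<times>\<times> Gb) (A i \<times> B i) (A j \<times> B j)) (x, y) =
        count (group_mset la Ga) x * count (group_mset lb Gb) y"
      using count_diff_mset_DirProd[OF groups finAB(1)[OF ij(1)] finAB(1)[OF ij(2)]
          finAB(2)[OF ij(1)] finAB(2)[OF ij(2)]] A[OF ij(2)] B[OF ij(2)] diff[OF ij]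
      by simp
    \<comment> \<open>Here \<open>(x, y)\<close> is an arbitrary pair of the type: if a coordinate
      lies outside its carrier, both sides are 0; otherwise both are \<open>la * lb\<close>.\<close>
    also have "\<dots> = count (group_mset (la * lb) (Ga \<times>\<times> Gb)) (x, y)"
      using fin by (simp add: count_group_mset)
    finally show "count (diff_mset (Ga \<times>\<times> Gb) (A i \<times> B i) (A j \<times> B j)) z =
        count (group_mset (la * lb) (Ga \<times>\<times> Gb)) z"
      by (simp add: z)
  qed
  moreover have "A i \<times> B i \<subseteq> carrier (Ga \<times>\<times> Gb) \<and> card (A i \<times> B i) = ka * kb"
    if "i \<in> {1..m}" for i
    using A[OF that] B[OF that] by (auto simp: card_cartesian_product)
  moreover have "order (Ga \<times>\<times> Gb) = na * nb"
    using ord by (simp add: order_def card_cartesian_product)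
  ultimately show ?thesis
    using groups fin m by (simp add: nondisjoint_PSEDF_def DirProd_group)
qed

end
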